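(* Suppose that a locally Lipschitz function $f:\mathbb{R}^d\to\mathbb{R}^m$ satisfies the $(\alpha,\beta)$ subgradient growth condition. Then for all $\mathbf{x},\mathbf{y}\in\mathbb{R}^d$, $$\|f(\mathbf{x})-f(\mathbf{y})\|\le\big(\alpha(\mathbf{x})+\beta(\mathbf{x},\|\mathbf{y}-\mathbf{x}\|)\big)\|\mathbf{x}-\mathbf{y}\|.$$
   Context: $\|\cdot\|$ is the Euclidean norm on vectors. For locally Lipschitz $f:\mathbb{R}^d\to\mathbb{R}^m$, $\partial f(\mathbf{x})$ denotes the Clarke subdifferential (generalized Jacobian): the convex hull of all limits $\lim_k \nabla f(\mathbf{x}_k)$ with $\mathbf{x}_k\to\mathbf{x}$ and $f$ differentiable at $\mathbf{x}_k$; for $m>1$ its elements are matrices, measured in the operator norm. Subgradient growth condition: let $\alpha:\mathbb{R}^d\to\mathbb{R}_+$ and $\beta:\mathbb{R}^d\times\mathbb{R}_+\to\mathbb{R}_+$ be continuous, with $\beta(\mathbf{x},r)$ non-decreasing in $r$. The function $f$ satisfies the $(\alpha,\beta)$ subgradient growth condition if $\sup_{\zeta\in\partial f(\mathbf{x})}\|\zeta\|\le\alpha(\mathbf{x})$ for all $\mathbf{x}$, and $|\alpha(\mathbf{x})-\alpha(\mathbf{y})|\le\beta(\mathbf{x},\|\mathbf{y}-\mathbf{x}\|)$ for all $\mathbf{x},\mathbf{y}\in\mathbb{R}^d$. *)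

theory Defs
  imports "HOL-Analysis.Analysis"
begin

definition locally_lipschitz :: "('a::metric_space \<Rightarrow> 'b::metric_space) \<Rightarrow> bool" where
  "locally_lipschitz f \<longleftrightarrow> (\<forall>x. \<exists>u>0. \<exists>L. L-lipschitz_on (ball x u) f)"

text \<open>An element of the Clarke subdifferential of a map into \<open>real^'m\<close> is an
  \<open>m \<times> d\<close> matrix, also for \<open>m = 1\<close>, where it is the row vector of a gradient and its
  operator norm is the Euclidean norm of that gradient.\<close>

definition clarke_subdifferential :: "(real^'d \<Rightarrow> real^'m) \<Rightarrow> real^'d \<Rightarrow> (real^'d^'m) set" where
  "clarke_subdifferential f x = convex hull
     {J. \<exists>X. X \<longlonglongrightarrow> x \<and> (\<forall>k. f differentiable (at (X k))) \<and>
             (\<lambda>k. jacobian f (at (X k))) \<longlonglongrightarrow> J}"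

text \<open>The supremum is taken in the extended reals because \<open>Sup\<close> on \<open>real\<close> is unspecified for
  sets that are empty or unbounded. The library's \<open>norm\<close> on \<open>real^'d^'m\<close> is the Frobenius
  norm, so the operator norm is written with \<open>onorm\<close>.\<close>

definition subgradient_growth ::
    "(real^'d \<Rightarrow> real^'m) \<Rightarrow> (real^'d \<Rightarrow> real) \<Rightarrow> (real^'d \<Rightarrow> real \<Rightarrow> real) \<Rightarrow> bool" where
  "subgradient_growth f \<alpha> \<beta> \<longleftrightarrow>
     (\<forall>x. (SUP \<zeta>\<in>clarke_subdifferential f x. ereal (onorm (\<lambda>v. \<zeta> *v v))) \<le> ereal (\<alpha> x)) \<and>
     (\<forall>x y. \<bar>\<alpha> x - \<alpha> y\<bar> \<le> \<beta> x (norm (y - x)))"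

end

theory Submission
  imports Defs
begin

text \<open>Wherever \<open>f\<close> is differentiable, its Jacobian belongs to the Clarke subdifferential, so the growth condition
bounds its operator norm at \<open>z\<close> by \<open>\<alpha> z \<le> \<alpha> x + \<beta> x (norm (z - x))\<close>. On the ball of radius
\<open>r + e\<close> around \<open>x\<close>, with \<open>r = norm (y - x)\<close>, monotonicity of \<open>\<beta> x\<close> makes this at most
\<open>\<alpha> x + \<beta> x (r + e)\<close>. A mean value inequality then bounds \<open>norm (f x - f y)\<close> by
\<open>(\<alpha> x + \<beta> x (r + e)) * r\<close>, and continuity of \<open>\<beta>\<close> allows \<open>e\<close> to tend to \<open>0\<close>.

The mean value inequality may use the bound only at points of differentiability, so there must be enough of
them: \<open>rademacher\<close> says that almost every point is one. Since the segment from \<open>x\<close> to \<open>y\<close> may contain none,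
\<open>lipschitz_increment_le_AE\<close> averages over a ball moving along it.

Rademacher's theorem is proved in three steps. A Lipschitz function on the line is differentiable almost
everywhere: if on a set of positive measure its lower derivative lay below \<open>p\<close> and its upper derivative
above \<open>q > p\<close>, two Vitali covering estimates would contradict each other (\<open>oscillating_null_real\<close>). Slicing by parallel lines gives
directional derivatives almost everywhere in Euclidean space. They are additive in the direction because the
defect has integral zero over every box (\<open>AE_dirderiv_add\<close>), and for a Lipschitz function a linear
derivative along a countable dense set of directions is a total derivative.\<close>

section \<open>Comparison of measures by Vitali covering\<close>

text \<open>Two local comparisons of measures are globalised by this lemma: increments of a monotone function against
length, and length against itself. The closed balls on which the inequality holds form a Vitali cover of
\<open>E\<close>; a disjoint countable subfamily inside \<open>U\<close> covers \<open>E\<close> up to a null set, and the inequality is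
summed over it.\<close>

lemma vitali_comparison:
  fixes E :: "'a::euclidean_space set"
  assumes E [measurable]: "E \<in> sets borel" and U: "open U" "E \<subseteq> U"
    and sets_\<nu>: "sets \<nu> = sets borel"
    and fine: "\<And>x d. x \<in> E \<Longrightarrow> 0 < d \<Longrightarrow> \<exists>c r. 0 < r \<and> r < d \<and> x \<in> cball c r \<and>
        s * emeasure lborel (E \<inter> cball c r) \<le> emeasure \<nu> (cball c r)"
  shows "s * emeasure lborel E \<le> emeasure \<nu> U"
proof -
  define K where "K = {(c, r). 0 < r \<and> cball c r \<subseteq> U \<and>
      s * emeasure lborel (E \<inter> cball c r) \<le> emeasure \<nu> (cball c r)}"
  have cover: "\<exists>i. i \<in> K \<and> x \<in> cball (fst i) (snd i) \<and> snd i < d" if "x \<in> E" "0 < d" for x d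
  proof -
    obtain e where e: "0 < e" "ball x e \<subseteq> U"
      using U \<open>x \<in> E\<close> by (meson openE subsetD)
    obtain c r where cr: "0 < r" "r < min d (e/2)" "x \<in> cball c r"
        "s * emeasure lborel (E \<inter> cball c r) \<le> emeasure \<nu> (cball c r)"
      using fine[OF \<open>x \<in> E\<close>, of "min d (e/2)"] \<open>0 < d\<close> e by auto
    have "cball c r \<subseteq> ball x e"
    proof
      fix y assume "y \<in> cball c r"
      then have "dist x y \<le> r + r"
        using cr(3) dist_triangle[of x y c] by (simp add: dist_commute)
      then show "y \<in> ball x e" using cr by simp
    qed
    then show ?thesis
      using cr e by (intro exI[of _ "(c, r)"]) (auto simp: K_def)
  qed
  have Kpos: "0 < snd i" if "i \<in> K" for i
    using that by (auto simp: K_def)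
  obtain C where C: "countable C" "C \<subseteq> K"
     "pairwise (\<lambda>i j. disjnt (cball (fst i) (snd i)) (cball (fst j) (snd j))) C"
     "negligible (E - (\<Union>i \<in> C. cball (fst i) (snd i)))"
    using Vitali_covering_theorem_cballs[of K snd E fst, OF Kpos cover] by auto
  define B where "B i = cball (fst i) (snd i)" for i :: "'a \<times> real"
  have B [measurable]: "B i \<in> sets borel" for i by (simp add: B_def)
  have disj: "disjoint_family_on B C"
    using C(3) by (auto simp: disjoint_family_on_def pairwise_def disjnt_def B_def)
  have UN [measurable]: "(\<Union>i\<in>C. B i) \<in> sets borel"
    using C(1) by (intro sets.countable_UN') auto
  have "E - (\<Union>i\<in>C. B i) \<in> null_sets lborel"
    using C(4) by (simp add: B_def negligible_iff_null_sets null_sets_completion_iff flip: B_def)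
  then have "emeasure lborel E = emeasure lborel (E - (E - (\<Union>i\<in>C. B i)))"
    by (intro emeasure_Diff_null_set[symmetric]) auto
  also have "E - (E - (\<Union>i\<in>C. B i)) = (\<Union>i\<in>C. E \<inter> B i)"
    by auto
  also have "emeasure lborel \<dots> = (\<integral>\<^sup>+i. emeasure lborel (E \<inter> B i) \<partial>count_space C)"
    using C(1) disj by (intro emeasure_UN_countable) (auto intro: disjoint_family_on_bisimulation[where f=B])
  finally have "s * emeasure lborel E = (\<integral>\<^sup>+i. s * emeasure lborel (E \<inter> B i) \<partial>count_space C)"
    by (simp add: nn_integral_cmult)
  also have "\<dots> \<le> (\<integral>\<^sup>+i. emeasure \<nu> (B i) \<partial>count_space C)"
    using C(2) by (intro nn_integral_mono) (auto simp: K_def B_def)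
  also have "\<dots> = emeasure \<nu> (\<Union>i\<in>C. B i)"
    using C(1) disj sets_\<nu> by (intro emeasure_UN_countable[symmetric]) auto
  also have "(\<Union>i\<in>C. B i) \<subseteq> U"
    using C(2) by (fastforce simp: K_def B_def)
  then have "emeasure \<nu> (\<Union>i\<in>C. B i) \<le> emeasure \<nu> U"
    using U(1) sets_\<nu> by (intro emeasure_mono) auto
  finally show ?thesis .
qed

section \<open>Lipschitz functions have directional derivatives almost everywhere\<close>

text \<open>A lower bound on the upper derivative at \<open>x\<close> along \<open>v\<close>, in a form that needs no limit superior and makes
Borel measurability visible. The lower derivative is reached by passing to \<open>- F\<close>.\<close>

definition steep :: "('a::real_normed_vector \<Rightarrow> real) \<Rightarrow> 'a \<Rightarrow> real \<Rightarrow> 'a set" where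
  "steep F v q = {x. \<forall>\<delta>>0. \<exists>h. h \<noteq> 0 \<and> \<bar>h\<bar> < \<delta> \<and> q < (F (x + h *\<^sub>R v) - F x) / h}"

text \<open>For a fixed increment the difference quotient is continuous, so the union over the uncountably many small
increments is an open set; only the bound \<open>\<delta>\<close> has to be made countable.\<close>

lemma steep_borel:
  assumes "continuous_on UNIV F"
  shows "steep F v q \<in> sets borel"
proof -
  define Q where "Q h = {x. q < (F (x + h *\<^sub>R v) - F x) / h}" for h
  have "open (Q h)" if "h \<noteq> 0" for h
    unfolding Q_def using that
    by (intro open_Collect_less continuous_intros continuous_on_compose2[OF assms]) auto
  moreover have "steep F v q = (\<Inter>n. \<Union>h\<in>{h. h \<noteq> 0 \<and> \<bar>h\<bar> < inverse (real (Suc n))}. Q h)"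
    (is "_ = ?R")
  proof
    show "steep F v q \<subseteq> ?R"
      by (fastforce simp: steep_def Q_def)
    show "?R \<subseteq> steep F v q"
    proof
      fix x assume x: "x \<in> ?R"
      have "\<exists>h. h \<noteq> 0 \<and> \<bar>h\<bar> < \<delta> \<and> q < (F (x + h *\<^sub>R v) - F x) / h" if \<delta>: "0 < \<delta>" for \<delta>
      proof -
        obtain n where n: "inverse (real (Suc n)) < \<delta>" using reals_Archimedean[OF \<delta>] by auto
        obtain h where "h \<noteq> 0" "\<bar>h\<bar> < inverse (real (Suc n))" "x \<in> Q h" using x by blast
        then show ?thesis using n by (intro exI[of _ h]) (auto simp: Q_def)
      qed
      then show "x \<in> steep F v q" by (simp add: steep_def)
    qed
  qed
  moreover have "(\<Inter>n. \<Union>h\<in>{h. h \<noteq> 0 \<and> \<bar>h\<bar> < inverse (real (Suc n))}. Q h) \<in> sets borel"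
    using calculation(1) by (intro sets.countable_INT'' borel_open open_UN ballI) auto
  ultimately show ?thesis by simp
qed

text \<open>Every point of \<open>A\<close> is an end point of arbitrarily short intervals over which \<open>g\<close> rises at slope at least \<open>s\<close>.
The Stieltjes measure of \<open>g\<close> therefore exceeds \<open>s\<close> times length on a Vitali cover of \<open>A\<close>.\<close>

lemma steep_emeasure_le:
  fixes g :: "real \<Rightarrow> real"
  assumes mono: "\<And>x y. x \<le> y \<Longrightarrow> g x \<le> g y" and cont: "continuous_on UNIV g"
    and A: "A \<in> sets borel" "A \<subseteq> steep g 1 s" "A \<subseteq> {a<..<b}" and "a \<le> b"
  shows "ennreal s * emeasure lborel A \<le> ennreal (g b - g a)"
proof -
  have "ennreal s * emeasure lborel A \<le> emeasure (interval_measure g) {a<..<b}"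
  proof (rule vitali_comparison)
    fix x d :: real assume "x \<in> A" "0 < d"
    then obtain h where h: "h \<noteq> 0" "\<bar>h\<bar> < d" "s < (g (x + h) - g x) / h"
      using A(2) by (force simp: steep_def)
    define c r where "c = x + h/2" and "r = \<bar>h\<bar>/2"
    have r: "0 < r" "r < d" using h by (auto simp: r_def)
    have x: "x \<in> cball c r" by (auto simp: c_def r_def dist_real_def)
    have inc: "s * (2 * r) \<le> g (c + r) - g (c - r)"
    proof (cases "h > 0")
      case True
      have "c + r = x + h" "c - r = x" "2 * r = h" using True by (auto simp: c_def r_def)
      then show ?thesis using True h(1,3) by (simp add: field_simps)
    next
      case False
      have "c + r = x" "c - r = x + h" "2 * r = - h" using False by (auto simp: c_def r_def)
      then show ?thesis using False h(1,3) by (simp add: field_simps)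
    qed
    have "ennreal s * emeasure lborel (A \<inter> cball c r) \<le> ennreal s * emeasure lborel {c-r..c+r}"
      by (intro mult_left_mono emeasure_mono) (auto simp: cball_eq_atLeastAtMost)
    also have "\<dots> = ennreal (s * (2 * r))"
      using r by (cases "0 \<le> s") (simp_all add: ennreal_mult'' ennreal_neg mult_nonpos_nonneg)
    also have "\<dots> \<le> emeasure (interval_measure g) (cball c r)"
      using r inc by (simp add: cball_eq_atLeastAtMost emeasure_interval_measure_Icc[OF _ mono cont] ennreal_leI)
    finally show "\<exists>c r. 0 < r \<and> r < d \<and> x \<in> cball c r \<and>
      ennreal s * emeasure lborel (A \<inter> cball c r) \<le> emeasure (interval_measure g) (cball c r)"
      using r x by blast
  qed (use A in auto)
  also have "\<dots> \<le> emeasure (interval_measure g) {a..b}"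
    by (intro emeasure_mono) auto
  also have "\<dots> = ennreal (g b - g a)"
    by (rule emeasure_interval_measure_Icc[OF \<open>a \<le> b\<close> mono cont])
  finally show ?thesis .
qed

text \<open>A weak form of the Lebesgue density theorem: a set of positive measure cannot have density bounded away
from \<open>1\<close> in all intervals. Covering the set inside an almost optimal open superset gives
\<open>c * \<bar>E\<bar> \<le> \<bar>E\<bar>\<close> with \<open>c > 1\<close>.\<close>

lemma null_if_uniformly_sparse:
  fixes E :: "real set"
  assumes E [measurable]: "E \<in> sets borel" and "c > (1::real)"
    and sparse: "\<And>a b. a < b \<Longrightarrow> ennreal c * emeasure lborel (E \<inter> {a<..<b}) \<le> ennreal (b - a)"
  shows "emeasure lborel E = 0"
proof -
  have bdd: "emeasure lborel (E \<inter> {-real n<..<real n}) = 0" for n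
  proof -
    \<comment> \<open>Cancelling below requires finite measure, hence the truncation.\<close>
    let ?E = "E \<inter> {-real n<..<real n}"
    have fin: "emeasure lborel ?E < \<infinity>"
      by (intro emeasure_bounded_finite bounded_subset[OF bounded_box[of "-real n" "real n"]]) auto
    have le: "ennreal c * emeasure lborel ?E \<le> emeasure lborel U" if "open U" "?E \<subseteq> U" for U
    proof (rule vitali_comparison)
      fix x d :: real assume "x \<in> ?E" "0 < d"
      have "ennreal c * emeasure lborel (?E \<inter> cball x (d/2))
          \<le> ennreal c * emeasure lborel (E \<inter> {x-d/2<..<x+d/2} \<union> {x-d/2, x+d/2})"
        by (intro mult_left_mono emeasure_mono) (auto simp: dist_real_def abs_real_def field_simps split: if_splits)
      also have "\<dots> = ennreal c * emeasure lborel (E \<inter> {x-d/2<..<x+d/2})"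
        by (subst emeasure_Un_null_set) (auto intro!: finite_imp_null_set_lborel)
      also have "\<dots> \<le> emeasure lborel (cball x (d/2))"
        using sparse[of "x-d/2" "x+d/2"] \<open>0 < d\<close> by (simp add: cball_eq_atLeastAtMost)
      finally show "\<exists>y r. 0 < r \<and> r < d \<and> x \<in> cball y r \<and>
         ennreal c * emeasure lborel (?E \<inter> cball y r) \<le> emeasure lborel (cball y r)"
        using \<open>0 < d\<close> by (intro exI[of _ x] exI[of _ "d/2"]) auto
    qed (use that in auto)
    have "ennreal c * emeasure lborel ?E \<le> emeasure lborel ?E + ennreal e" if e: "e > 0" for e
    proof -
      obtain U where U: "open U" "?E \<subseteq> U" "emeasure lborel (U - ?E) < ennreal e"
        by (rule outer_regular_lborel[of ?E e]) (use e in auto)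
      have "emeasure lborel U \<le> emeasure lborel ?E + emeasure lborel (U - ?E)"
        using U(1,2) by (intro order_trans[OF emeasure_mono emeasure_subadditive]) auto
      also have "\<dots> \<le> emeasure lborel ?E + ennreal e"
        using U(3) by (intro add_left_mono) auto
      finally show ?thesis using le[OF U(1,2)] by (rule order_trans[rotated])
    qed
    then have "ennreal c * emeasure lborel ?E \<le> emeasure lborel ?E"
      by (rule ennreal_le_epsilon)
    moreover obtain m where m: "emeasure lborel ?E = ennreal m" "0 \<le> m"
      using fin by (cases "emeasure lborel ?E") auto
    ultimately have "c * m \<le> m" using \<open>c > 1\<close> by (simp flip: ennreal_mult)
    then have "m = 0"
      using m(2) \<open>c > 1\<close> mult_strict_right_mono[of 1 c m] by (cases "m = 0") auto
    then show ?thesis using m by simp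
  qed
  have "E = (\<Union>n. E \<inter> {-real n<..<real n})"
  proof -
    have "\<exists>n. x \<in> {-real n<..<real n}" for x
      using reals_Archimedean2[of "\<bar>x\<bar>"] by (force simp: abs_less_iff)
    then show ?thesis by blast
  qed
  moreover have "emeasure lborel (\<Union>n. E \<inter> {-real n<..<real n}) = 0"
    using bdd by (intro emeasure_UN_eq_0) auto
  ultimately show ?thesis by simp
qed

text \<open>Difference quotients at arbitrarily small scales lie below \<open>p\<close> and above \<open>q\<close>: for \<open>p < q\<close> this is the obstruction
to the existence of the derivative along \<open>v\<close>.\<close>

definition oscillating :: "('a::real_normed_vector \<Rightarrow> real) \<Rightarrow> 'a \<Rightarrow> real \<Rightarrow> real \<Rightarrow> 'a set" where
  "oscillating F v p q = steep F v q \<inter> steep (\<lambda>x. - F x) v (- p)"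

lemma oscillating_borel: "continuous_on UNIV F \<Longrightarrow> oscillating F v p q \<in> sets borel"
  unfolding oscillating_def by (intro sets.Int steep_borel continuous_on_minus)

lemma steep_add_linear:
  "steep (\<lambda>t. g t + c * t) 1 (q + c) = steep g 1 (q::real)"
proof -
  have "(g (x + h) + c * (x + h) - (g x + c * x)) / h = (g (x + h) - g x) / h + c" if "h \<noteq> 0" for x h :: real
    using that by (simp add: field_simps)
  then show ?thesis
    unfolding steep_def by (auto cong: conj_cong)
qed

text \<open>Adding a steep linear function turns \<open>f\<close> and \<open>- f\<close> into the monotone functions \<open>f + M t\<close>
and \<open>- f + M t\<close>. On \<open>E \<inter> {a<..<b}\<close> they are steep with slopes \<open>q + M\<close> and \<open>M - p\<close>; adding the two
resulting estimates, the increments of \<open>f\<close> cancel and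
\<open>(2 M + (q - p)) * \<bar>E \<inter> {a<..<b}\<bar> \<le> 2 M * (b - a)\<close> remains, so \<open>E\<close> is uniformly sparse.\<close>

lemma oscillating_null_real:
  fixes f :: "real \<Rightarrow> real"
  assumes lip: "L-lipschitz_on UNIV f" and "p < q"
  shows "emeasure lborel (oscillating f 1 p q) = 0"
proof -
  \<comment> \<open>Any Lipschitz constant that also makes both slopes nonnegative.\<close>
  define M where "M = L + \<bar>p\<bar> + \<bar>q\<bar> + 1"
  have "L \<ge> 0" using lip by (rule lipschitz_on_nonneg)
  have lipM: "\<bar>f x - f y\<bar> \<le> M * \<bar>x - y\<bar>" for x y
    using lipschitz_on_mono[OF lip, of UNIV M] lipschitz_onD[of M UNIV f x y]
    by (auto simp: M_def dist_real_def)
  have M: "0 < M" "0 \<le> q + M" "0 \<le> M - p" using \<open>L \<ge> 0\<close> by (auto simp: M_def)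
  have cont: "continuous_on UNIV f"
    using lip by (rule lipschitz_on_continuous_on)
  let ?E = "oscillating f 1 p q"
  define c where "c = (2 * M + (q - p)) / (2 * M)"
  have "c > 1" using M \<open>p < q\<close> by (simp add: c_def)
  show ?thesis
  proof (rule null_if_uniformly_sparse)
    fix a b :: real assume "a < b"
    let ?A = "?E \<inter> {a<..<b}"
    have fin: "emeasure lborel ?A < \<infinity>"
      by (intro emeasure_bounded_finite bounded_subset[OF bounded_box[of a b]]) auto
    then obtain m where m: "emeasure lborel ?A = ennreal m" "0 \<le> m"
      by (cases "emeasure lborel ?A") auto
    have A: "?A \<in> sets borel"
      using oscillating_borel[OF cont, of 1 p q] by auto
    have "ennreal (q + M) * emeasure lborel ?A \<le> ennreal ((f b + M * b) - (f a + M * a))"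
    proof (rule steep_emeasure_le[where g = "\<lambda>t. f t + M * t"])
      show "f x + M * x \<le> f y + M * y" if "x \<le> y" for x y
        using lipM[of x y] that by (simp add: algebra_simps)
      show "?A \<subseteq> steep (\<lambda>t. f t + M * t) 1 (q + M)"
        by (auto simp: steep_add_linear oscillating_def)
    qed (use A \<open>a < b\<close> in \<open>auto intro!: continuous_intros cont\<close>)
    moreover have "ennreal ((q + M) * m) = ennreal (q + M) * ennreal m"
      using M m by (intro ennreal_mult)
    ultimately have "ennreal ((q + M) * m) \<le> ennreal ((f b - f a) + M * (b - a))"
      using m by (simp add: algebra_simps)
    moreover have "0 \<le> (f b - f a) + M * (b - a)"
      using lipM[of a b] \<open>a < b\<close> by (simp add: algebra_simps abs_le_iff)
    ultimately have 1: "(q + M) * m \<le> (f b - f a) + M * (b - a)"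
      by simp
    have "ennreal (- p + M) * emeasure lborel ?A \<le> ennreal ((- f b + M * b) - (- f a + M * a))"
    proof (rule steep_emeasure_le[where g = "\<lambda>t. - f t + M * t"])
      show "- f x + M * x \<le> - f y + M * y" if "x \<le> y" for x y
        using lipM[of x y] that by (simp add: algebra_simps)
      show "?A \<subseteq> steep (\<lambda>t. - f t + M * t) 1 (- p + M)"
        using steep_add_linear[of "\<lambda>t. - f t" M "- p"] by (auto simp: oscillating_def)
    qed (use A \<open>a < b\<close> in \<open>auto intro!: continuous_intros cont\<close>)
    moreover have "ennreal ((M - p) * m) = ennreal (M - p) * ennreal m"
      using M m by (intro ennreal_mult)
    ultimately have "ennreal ((M - p) * m) \<le> ennreal (M * (b - a) - (f b - f a))"
      using m by (simp add: algebra_simps)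
    moreover have "0 \<le> M * (b - a) - (f b - f a)"
      using lipM[of a b] \<open>a < b\<close> by (simp add: algebra_simps abs_le_iff)
    ultimately have 2: "(M - p) * m \<le> M * (b - a) - (f b - f a)"
      by simp
    have "(2 * M + (q - p)) * m \<le> 2 * M * (b - a)"
      using 1 2 by (simp add: algebra_simps)
    then have "c * m \<le> b - a"
      using M by (simp add: c_def field_simps)
    then show "ennreal c * emeasure lborel ?A \<le> ennreal (b - a)"
      using m \<open>c > 1\<close> by (simp flip: ennreal_mult add: ennreal_leI)
  qed (use \<open>c > 1\<close> oscillating_borel[OF cont] in auto)
qed

lemma nn_integral_lborel_shift:
  fixes f :: "'a::euclidean_space \<Rightarrow> ennreal"
  assumes [measurable]: "f \<in> borel_measurable borel"
  shows "(\<integral>\<^sup>+x. f (x + c) \<partial>lborel) = (\<integral>\<^sup>+x. f x \<partial>lborel)"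
proof -
  have "(\<integral>\<^sup>+x. f x \<partial>lborel) = (\<integral>\<^sup>+x. f x \<partial>distr lborel borel ((+) c))"
    by (simp add: lborel_distr_plus)
  also have "\<dots> = (\<integral>\<^sup>+x. f (c + x) \<partial>lborel)"
    by (subst nn_integral_distr) auto
  finally show ?thesis by (simp add: add.commute)
qed

text \<open>Fubini's theorem without a choice of coordinates adapted to \<open>v\<close>: by translation invariance \<open>\<bar>N\<bar>\<close> is the
average over \<open>t \<in> {0..1}\<close> of \<open>\<bar>N - t v\<bar>\<close>, and exchanging the integrals leaves the measures of the slices.\<close>

lemma null_if_line_slices_null:
  fixes N :: "'a::euclidean_space set"
  assumes N [measurable]: "N \<in> sets borel"
    and slices: "\<And>x. emeasure lborel {t::real. x + t *\<^sub>R v \<in> N} = 0"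
  shows "emeasure lborel N = 0"
proof -
  have "emeasure lborel N = (\<integral>\<^sup>+t. emeasure lborel N * indicator {0..1::real} t \<partial>lborel)"
    by (simp add: nn_integral_cmult)
  also have "\<dots> = (\<integral>\<^sup>+t. (\<integral>\<^sup>+x. indicator N (x + t *\<^sub>R v) * indicator {0..1::real} t \<partial>lborel) \<partial>lborel)"
    by (intro nn_integral_cong, subst nn_integral_multc)
       (simp_all add: nn_integral_lborel_shift[of "indicator N"])
  also have "\<dots> = (\<integral>\<^sup>+x. (\<integral>\<^sup>+t. indicator N (x + t *\<^sub>R v) * indicator {0..1::real} t \<partial>lborel) \<partial>lborel)"
    by (rule lborel_pair.Fubini') measurable
  also have "\<dots> = (\<integral>\<^sup>+x. 0 \<partial>(lborel :: 'a measure))"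
  proof (rule nn_integral_cong)
    fix x :: 'a
    have "(\<integral>\<^sup>+t. indicator N (x + t *\<^sub>R v) * indicator {0..1::real} t \<partial>lborel)
        \<le> (\<integral>\<^sup>+t. indicator {t. x + t *\<^sub>R v \<in> N} t \<partial>lborel)"
      by (intro nn_integral_mono) (auto split: split_indicator)
    also have "\<dots> = emeasure lborel {t. x + t *\<^sub>R v \<in> N}"
      by (rule nn_integral_indicator) measurable
    finally show "(\<integral>\<^sup>+t. indicator N (x + t *\<^sub>R v) * indicator {0..1::real} t \<partial>lborel) = 0"
      using slices[of x] by simp
  qed
  finally show ?thesis by simp
qed

lemma oscillating_null:
  fixes F :: "'a::euclidean_space \<Rightarrow> real"
  assumes lip: "L-lipschitz_on UNIV F" and "p < q"
  shows "emeasure lborel (oscillating F v p q) = 0"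
proof (rule null_if_line_slices_null)
  show "oscillating F v p q \<in> sets borel"
    using lip by (intro oscillating_borel lipschitz_on_continuous_on)
  fix x
  have "(L * norm v)-lipschitz_on UNIV (\<lambda>t::real. F (x + t *\<^sub>R v))"
  proof (rule lipschitz_onI)
    fix s t :: real
    have "dist (F (x + s *\<^sub>R v)) (F (x + t *\<^sub>R v)) \<le> L * dist (x + s *\<^sub>R v) (x + t *\<^sub>R v)"
      using lip by (rule lipschitz_onD) auto
    also have "dist (x + s *\<^sub>R v) (x + t *\<^sub>R v) = norm v * dist s t"
      by (simp add: dist_norm flip: scaleR_diff_left)
    finally show "dist (F (x + s *\<^sub>R v)) (F (x + t *\<^sub>R v)) \<le> L * norm v * dist s t"
      by (simp add: mult.assoc)
  qed (use lipschitz_on_nonneg[OF lip] in simp)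
  from oscillating_null_real[OF this \<open>p < q\<close>]
  show "emeasure lborel {t. x + t *\<^sub>R v \<in> oscillating F v p q} = 0"
    by (simp add: oscillating_def steep_def scaleR_add_left add.assoc Int_def)
qed

text \<open>If the limit did not exist, two rationals would separate the lower from the upper limit. Rational bounds
keep the family of exceptional sets countable.\<close>

lemma bounded_tendsto_if_not_oscillating:
  fixes Q :: "'a \<Rightarrow> real"
  assumes nt: "\<not> trivial_limit \<F>" and bdd: "\<And>h. \<bar>Q h\<bar> \<le> K"
    and osc: "\<And>p q. p \<in> \<rat> \<Longrightarrow> q \<in> \<rat> \<Longrightarrow> p < q \<Longrightarrow> (\<forall>\<^sub>F h in \<F>. Q h \<le> q) \<or> (\<forall>\<^sub>F h in \<F>. p \<le> Q h)"
  shows "\<exists>l. (Q \<longlongrightarrow> l) \<F>"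
proof -
  let ?Q = "\<lambda>h. ereal (Q h)"
  have bounds: "ereal (- K) \<le> Liminf \<F> ?Q" "Limsup \<F> ?Q \<le> ereal K"
    using bdd by (auto intro!: Liminf_bounded Limsup_bounded always_eventually simp: abs_le_iff minus_le_iff)
  have "Limsup \<F> ?Q \<le> Liminf \<F> ?Q"
  proof (rule ccontr)
    assume "\<not> ?thesis"
    then have lt: "Liminf \<F> ?Q < Limsup \<F> ?Q" by simp
    obtain a where a: "Liminf \<F> ?Q < ereal a" "ereal a < Limsup \<F> ?Q"
      using ereal_dense2[OF lt] by auto
    obtain b where b: "ereal a < ereal b" "ereal b < Limsup \<F> ?Q"
      using ereal_dense2[OF a(2)] by auto
    obtain c where c: "a < c" "c < b" using dense b(1) by auto
    obtain p where p: "p \<in> \<rat>" "a < p" "p < c" using Rats_dense_in_real[OF c(1)] by auto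
    obtain q where q: "q \<in> \<rat>" "c < q" "q < b" using Rats_dense_in_real[OF c(2)] by auto
    have "p < q" using p q by simp
    from osc[OF p(1) q(1) this] show False
    proof
      assume "\<forall>\<^sub>F h in \<F>. Q h \<le> q"
      then have "Limsup \<F> ?Q \<le> ereal q" by (intro Limsup_bounded) auto
      with b q show False by (meson ereal_less_le less_ereal.simps(1) not_le order_less_trans)
    next
      assume "\<forall>\<^sub>F h in \<F>. p \<le> Q h"
      then have "ereal p \<le> Liminf \<F> ?Q" by (intro Liminf_bounded) auto
      with a p show False by (meson less_ereal.simps(1) not_le order_less_trans)
    qed
  qed
  then have eq: "Liminf \<F> ?Q = Limsup \<F> ?Q"
    using Liminf_le_Limsup[OF nt, of ?Q] by simp
  with bounds obtain l where "Limsup \<F> ?Q = ereal l"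
    by (cases "Limsup \<F> ?Q") auto
  with eq have "(?Q \<longlongrightarrow> ereal l) \<F>"
    by (simp add: tendsto_iff_Liminf_eq_Limsup[OF nt])
  then show ?thesis unfolding lim_ereal by blast
qed

definition dquot :: "('a::real_normed_vector \<Rightarrow> real) \<Rightarrow> 'a \<Rightarrow> 'a \<Rightarrow> real \<Rightarrow> real" where
  "dquot F v x h = (F (x + h *\<^sub>R v) - F x) / h"

lemma abs_dquot_le:
  assumes "L-lipschitz_on UNIV F"
  shows "\<bar>dquot F v x h\<bar> \<le> L * norm v"
proof (cases "h = 0")
  case False
  have "\<bar>F (x + h *\<^sub>R v) - F x\<bar> \<le> L * (\<bar>h\<bar> * norm v)"
    using lipschitz_onD[OF assms, of "x + h *\<^sub>R v" x] by (simp add: dist_norm)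
  with False show ?thesis by (simp add: dquot_def field_simps abs_divide)
qed (use lipschitz_on_nonneg[OF assms] in \<open>simp add: dquot_def\<close>)

lemma AE_directional_derivative_exists:
  fixes F :: "'a::euclidean_space \<Rightarrow> real"
  assumes lip: "L-lipschitz_on UNIV F"
  shows "AE x in lborel. \<exists>l. (dquot F v x \<longlongrightarrow> l) (at 0)"
proof -
  have cont: "continuous_on UNIV F" using lip by (rule lipschitz_on_continuous_on)
  have "AE x in lborel. \<forall>p\<in>\<rat>. \<forall>q\<in>\<rat>. p < q \<longrightarrow> x \<notin> oscillating F v p q"
  proof -
    have "AE x in lborel. p < q \<longrightarrow> x \<notin> oscillating F v p q" for p q
    proof (cases "p < q")
      case True
      then have "oscillating F v p q \<in> null_sets lborel"
        using oscillating_null[OF lip True] oscillating_borel[OF cont] by (auto simp: null_sets_def)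
      then show ?thesis by (auto dest: AE_not_in)
    qed auto
    then show ?thesis by (simp add: AE_ball_countable countable_rat)
  qed
  then show ?thesis
  proof eventually_elim
    case (elim x)
    show ?case
    proof (rule bounded_tendsto_if_not_oscillating)
      fix p q :: real assume pq: "p \<in> \<rat>" "q \<in> \<rat>" "p < q"
      have "\<forall>\<^sub>F h in at 0. dquot F v x h \<le> q" if "x \<notin> steep F v q"
        using that by (force simp: steep_def dquot_def eventually_at not_less)
      moreover have "\<forall>\<^sub>F h in at 0. p \<le> dquot F v x h" if "x \<notin> steep (\<lambda>x. - F x) v (- p)"
      proof -
        have "(- F (x + h *\<^sub>R v) - - F x) / h = - dquot F v x h" for h
          unfolding dquot_def minus_divide_left[symmetric] by (simp add: minus_divide_left)
        then show ?thesis
          using that by (force simp: steep_def eventually_at not_less)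
      qed
      ultimately show "(\<forall>\<^sub>F h in at 0. dquot F v x h \<le> q) \<or> (\<forall>\<^sub>F h in at 0. p \<le> dquot F v x h)"
        using elim pq by (auto simp: oscillating_def)
    qed (use abs_dquot_le[OF lip] in auto)
  qed
qed

section \<open>Linearity of directional derivatives\<close>

text \<open>The limit is taken along a fixed sequence so that measurability in \<open>x\<close> is immediate; where the directional
derivative exists the value does not depend on that sequence.\<close>

definition dirderiv :: "('a::real_normed_vector \<Rightarrow> real) \<Rightarrow> 'a \<Rightarrow> 'a \<Rightarrow> real" where
  "dirderiv F v x = lim (\<lambda>n. dquot F v x (inverse (real (Suc n))))"

lemma filterlim_inverse_Suc_at_0: "filterlim (\<lambda>n. inverse (real (Suc n))) (at 0) sequentially"
  by (simp add: filterlim_at LIMSEQ_inverse_real_of_nat del: of_nat_Suc)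

lemma dquot_zero: "dquot F 0 x = (\<lambda>h. 0)"
  by (simp add: dquot_def fun_eq_iff)

lemma dirderiv_eqI:
  assumes "(dquot F v x \<longlongrightarrow> l) (at 0)"
  shows "dirderiv F v x = l"
  unfolding dirderiv_def
  by (intro limI filterlim_compose[OF assms filterlim_inverse_Suc_at_0])

lemma AE_dirderiv:
  fixes F :: "'a::euclidean_space \<Rightarrow> real"
  assumes "L-lipschitz_on UNIV F"
  shows "AE x in lborel. (dquot F v x \<longlongrightarrow> dirderiv F v x) (at 0)"
  using AE_directional_derivative_exists[OF assms, of v]
  by eventually_elim (auto dest: dirderiv_eqI)

lemma dquot_measurable:
  fixes F :: "'a::euclidean_space \<Rightarrow> real"
  assumes "continuous_on UNIV F"
  shows "(\<lambda>x. dquot F v x h) \<in> borel_measurable borel"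
proof -
  have [measurable]: "F \<in> borel_measurable borel"
    using assms by (rule borel_measurable_continuous_onI)
  show ?thesis unfolding dquot_def by measurable
qed

lemma dirderiv_measurable:
  fixes F :: "'a::euclidean_space \<Rightarrow> real"
  assumes "continuous_on UNIV F"
  shows "dirderiv F v \<in> borel_measurable borel"
  unfolding dirderiv_def using dquot_measurable[OF assms] by measurable

lemma abs_dirderiv_le:
  assumes "L-lipschitz_on UNIV F" and "(dquot F v x \<longlongrightarrow> l) (at 0)"
  shows "\<bar>l\<bar> \<le> L * norm v"
  using tendsto_rabs[OF assms(2)]
  by (rule tendsto_upperbound) (auto simp: abs_dquot_le[OF assms(1)])

lemma integrable_indicator_mult_bounded:
  fixes g :: "'a::euclidean_space \<Rightarrow> real"
  assumes "g \<in> borel_measurable borel" "S \<in> sets borel" "bounded S"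
    and "AE x in lborel. x \<in> S \<longrightarrow> \<bar>g x\<bar> \<le> K"
  shows "integrable lborel (\<lambda>x. indicator S x * g x)"
proof -
  have "integrable lborel (\<lambda>x. indicator S x *\<^sub>R g x)"
    using assms emeasure_bounded_finite[OF assms(3)]
    by (intro integrableI_bounded_set_indicator[where B = K]) auto
  then show ?thesis by simp
qed

text \<open>The density \<open>1 + \<psi> / K\<close> is nonnegative and yields a measure that agrees with Lebesgue measure on boxes, so
it is Lebesgue measure, and the density is \<open>1\<close> almost everywhere.\<close>

lemma AE_zero_if_box_integrals_zero:
  fixes \<psi> :: "'a::euclidean_space \<Rightarrow> real"
  assumes [measurable]: "\<psi> \<in> borel_measurable borel"
    and bdd: "AE x in lborel. \<bar>\<psi> x\<bar> \<le> K" and "0 < K"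
    and zero: "\<And>l u. (\<integral>x. indicator (box l u) x * \<psi> x \<partial>lborel) = 0"
  shows "AE x in lborel. \<psi> x = 0"
proof -
  define \<phi> where "\<phi> x = 1 + \<psi> x / K" for x
  have [measurable]: "\<phi> \<in> borel_measurable borel" by (simp add: \<phi>_def[abs_def])
  have nonneg: "AE x in lborel. 0 \<le> \<phi> x"
    using bdd by eventually_elim (use \<open>0 < K\<close> in \<open>auto simp: \<phi>_def field_simps abs_le_iff\<close>)
  have "lborel = density lborel (\<lambda>x. ennreal (\<phi> x))"
  proof (rule lborel_eqI)
    fix l u :: 'a
    assume lu: "\<And>b. b \<in> Basis \<Longrightarrow> l \<bullet> b \<le> u \<bullet> b"
    have int1: "integrable lborel (\<lambda>x. indicator (box l u) x :: real)"
      by (rule integrable_real_indicator) (use emeasure_bounded_finite[OF bounded_box] in auto)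
    have int2: "integrable lborel (\<lambda>x. indicator (box l u) x * \<psi> x)"
      using bdd by (intro integrable_indicator_mult_bounded) auto
    have eq: "\<phi> x * indicator (box l u) x = indicator (box l u) x + indicator (box l u) x * \<psi> x / K" for x
      by (auto simp: \<phi>_def split: split_indicator)
    have "emeasure (density lborel (\<lambda>x. ennreal (\<phi> x))) (box l u)
        = (\<integral>\<^sup>+x. ennreal (\<phi> x) * indicator (box l u) x \<partial>lborel)"
      by (rule emeasure_density) auto
    also have "\<dots> = (\<integral>\<^sup>+x. ennreal (\<phi> x * indicator (box l u) x) \<partial>lborel)"
      by (intro nn_integral_cong) (auto split: split_indicator)
    also have "\<dots> = ennreal (\<integral>x. \<phi> x * indicator (box l u) x \<partial>lborel)"
    proof (rule nn_integral_eq_integral)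
      show "integrable lborel (\<lambda>x. \<phi> x * indicator (box l u) x)"
        unfolding eq using int1 int2 by auto
      show "AE x in lborel. 0 \<le> \<phi> x * indicator (box l u) x"
        using nonneg by eventually_elim auto
    qed
    also have "(\<integral>x. \<phi> x * indicator (box l u) x \<partial>lborel) = measure lborel (box l u)"
      unfolding eq using int1 int2 zero[of l u] by simp
    also have "ennreal \<dots> = emeasure lborel (box l u)"
      by (intro emeasure_eq_ennreal_measure[symmetric]) (simp add: emeasure_lborel_box_eq)
    finally show "emeasure (density lborel (\<lambda>x. ennreal (\<phi> x))) (box l u) = (\<Prod>b\<in>Basis. (u - l) \<bullet> b)"
      using lu by simp
  qed simp
  then have "density lborel (\<lambda>x. ennreal (\<phi> x)) = density lborel (\<lambda>x. 1)"
    by (simp add: density_1)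
  then have "AE x in lborel. ennreal (\<phi> x) = 1"
    by (intro sigma_finite_measure.density_unique[OF sigma_finite_lborel]) auto
  then show ?thesis
    by eventually_elim (use \<open>0 < K\<close> in \<open>simp add: \<phi>_def ennreal_eq_1\<close>)
qed

lemma integral_lborel_shift:
  fixes f :: "'a::euclidean_space \<Rightarrow> real"
  assumes [measurable]: "f \<in> borel_measurable borel"
  shows "(\<integral>x. f (x + c) \<partial>lborel) = (\<integral>x. f x \<partial>lborel)"
proof -
  have "(\<integral>x. f x \<partial>lborel) = (\<integral>x. f x \<partial>distr lborel borel ((+) c))"
    by (simp add: lborel_distr_plus)
  also have "\<dots> = (\<integral>x. f (c + x) \<partial>lborel)"
    by (subst integral_distr) auto
  finally show ?thesis by (simp add: add.commute)
qed

lemma AE_not_in_frontier_box: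
  fixes l u :: "'a::euclidean_space"
  shows "AE x in lborel. x \<notin> frontier (box l u)"
proof (rule AE_not_in)
  show "frontier (box l u) \<in> null_sets lborel"
    using negligible_convex_frontier[OF convex_box(2), of l u]
    by (simp add: negligible_iff_null_sets null_sets_completion_iff)
qed

text \<open>The difference quotient along \<open>v + w\<close> at \<open>x\<close> is the one along \<open>v\<close> at \<open>x\<close> plus the one along \<open>w\<close> at the moved
point \<open>x + h v\<close>. Pointwise nothing controls that displacement, but in the integral over a box it can be
shifted onto the indicator of the box, which converges away from the boundary as \<open>h\<close> tends to \<open>0\<close>. The defect of
additivity thus integrates to zero over every box.\<close>

lemma AE_dirderiv_add:
  fixes F :: "'a::euclidean_space \<Rightarrow> real"
  assumes lip: "L-lipschitz_on UNIV F"
  shows "AE x in lborel. dirderiv F (v + w) x = dirderiv F v x + dirderiv F w x"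
proof -
  have cont: "continuous_on UNIV F" using lip by (rule lipschitz_on_continuous_on)
  have L: "0 \<le> L" using lip by (rule lipschitz_on_nonneg)
  note [measurable] = dquot_measurable[OF cont] dirderiv_measurable[OF cont]
  define h where "h n = inverse (real (Suc n))" for n
  have h: "filterlim h (at 0) sequentially" "h \<longlonglongrightarrow> 0"
    using filterlim_inverse_Suc_at_0 LIMSEQ_inverse_real_of_nat by (auto simp: h_def[abs_def])
  have h1: "\<bar>h n\<bar> \<le> 1" "h n \<noteq> 0" for n by (auto simp: h_def field_simps)
  define \<psi> where "\<psi> x = dirderiv F (v + w) x - dirderiv F v x - dirderiv F w x" for x
  define \<psi>n where "\<psi>n n x = dquot F (v + w) x (h n) - dquot F v x (h n) - dquot F w x (h n)" for n x
  define K where "K = L * norm (v + w) + L * norm v + L * norm w"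
  have [measurable]: "\<psi> \<in> borel_measurable borel" "\<psi>n n \<in> borel_measurable borel" for n
    by (simp_all add: \<psi>_def[abs_def] \<psi>n_def[abs_def])
  have \<psi>n_le: "\<bar>\<psi>n n x\<bar> \<le> K" for n x
    using abs_dquot_le[OF lip, of "v + w" x "h n"] abs_dquot_le[OF lip, of v x "h n"]
      abs_dquot_le[OF lip, of w x "h n"] by (auto simp: \<psi>n_def K_def)
  have \<psi>n_lim: "AE x in lborel. (\<lambda>n. \<psi>n n x) \<longlonglongrightarrow> \<psi> x"
    using AE_dirderiv[OF lip, of "v + w"] AE_dirderiv[OF lip, of v] AE_dirderiv[OF lip, of w]
    by eventually_elim
      (unfold \<psi>_def \<psi>n_def, intro tendsto_diff; erule filterlim_compose[OF _ h(1)])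
  have "AE x in lborel. \<psi> x = 0"
  proof (rule AE_zero_if_box_integrals_zero[where K = "K + 1"])
    show "AE x in lborel. \<bar>\<psi> x\<bar> \<le> K + 1"
      using \<psi>n_lim
    proof eventually_elim
      case (elim x)
      have "\<bar>\<psi> x\<bar> \<le> K"
        using tendsto_rabs[OF elim] by (rule tendsto_upperbound) (auto simp: \<psi>n_le)
      then show ?case by simp
    qed
    show "0 < K + 1" using L by (simp add: K_def add_nonneg_pos)
    fix l u :: 'a
    let ?B = "box l u"
    have lim1: "(\<lambda>n. \<integral>x. indicator ?B x * \<psi>n n x \<partial>lborel) \<longlonglongrightarrow> (\<integral>x. indicator ?B x * \<psi> x \<partial>lborel)"
    proof (rule integral_dominated_convergence[where w = "\<lambda>x. indicator ?B x * K"])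
      show "integrable lborel (\<lambda>x. indicator ?B x * K)"
        by (rule integrable_indicator_mult_bounded[where K = "\<bar>K\<bar>"]) auto
      show "AE x in lborel. (\<lambda>n. indicator ?B x * \<psi>n n x) \<longlonglongrightarrow> indicator ?B x * \<psi> x"
        using \<psi>n_lim by eventually_elim (intro tendsto_intros)
    qed (auto simp: \<psi>n_le abs_mult split: split_indicator)
    obtain R where R: "\<And>x. x \<in> ?B \<Longrightarrow> norm x \<le> R"
      using bounded_box[of l u] unfolding bounded_iff by blast
    \<comment> \<open>The increments have absolute value at most 1, so this ball contains the box and all its shifts.\<close>
    let ?C = "cball 0 (R + norm v) :: 'a set"
    have shift: "(\<integral>x. indicator ?B x * \<psi>n n x \<partial>lborel)
        = (\<integral>y. (indicator ?B (y - h n *\<^sub>R v) - indicator ?B y) * dquot F w y (h n) \<partial>lborel)" for n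
    proof -
      have int: "integrable lborel (\<lambda>x. indicator ?B x * dquot F w x (h n))"
        by (rule integrable_indicator_mult_bounded[where K = "L * norm w"])
           (auto simp: abs_dquot_le[OF lip])
      have int': "integrable lborel (\<lambda>x. indicator ?B x * dquot F w (x + h n *\<^sub>R v) (h n))"
        by (rule integrable_indicator_mult_bounded[where K = "L * norm w"])
           (auto simp: abs_dquot_le[OF lip])
      have "integrable lborel (\<lambda>y. indicator ((+) (h n *\<^sub>R v) ` ?B) y * dquot F w y (h n))"
        by (rule integrable_indicator_mult_bounded[where K = "L * norm w"])
           (auto simp: abs_dquot_le[OF lip] intro!: bounded_translation borel_open open_translation)
      moreover have "indicator ((+) (h n *\<^sub>R v) ` ?B) y = (indicator ?B (y - h n *\<^sub>R v) :: real)" for y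
        by (auto simp: indicator_def image_iff algebra_simps intro!: bexI[of _ "y - h n *\<^sub>R v"])
      ultimately have int'': "integrable lborel (\<lambda>y. indicator ?B (y - h n *\<^sub>R v) * dquot F w y (h n))"
        by simp
      have "\<psi>n n x = dquot F w (x + h n *\<^sub>R v) (h n) - dquot F w x (h n)" for x
        by (simp add: \<psi>n_def dquot_def scaleR_add_right add.assoc flip: diff_divide_distrib)
      then have "(\<integral>x. indicator ?B x * \<psi>n n x \<partial>lborel)
          = (\<integral>x. indicator ?B x * dquot F w (x + h n *\<^sub>R v) (h n) \<partial>lborel)
            - (\<integral>x. indicator ?B x * dquot F w x (h n) \<partial>lborel)"
        using int int' by (simp add: right_diff_distrib)
      also have "(\<integral>x. indicator ?B x * dquot F w (x + h n *\<^sub>R v) (h n) \<partial>lborel)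
          = (\<integral>y. indicator ?B (y - h n *\<^sub>R v) * dquot F w y (h n) \<partial>lborel)"
        using integral_lborel_shift[of "\<lambda>y. indicator ?B (y - h n *\<^sub>R v) * dquot F w y (h n)" "h n *\<^sub>R v"]
        by simp
      finally show ?thesis
        using int int'' by (simp add: left_diff_distrib)
    qed
    have "(\<lambda>n. \<integral>x. indicator ?B x * \<psi>n n x \<partial>lborel) \<longlonglongrightarrow> (\<integral>x. 0 \<partial>(lborel :: 'a measure))"
      unfolding shift
    proof (rule integral_dominated_convergence[where w = "\<lambda>x. indicator ?C x * (L * norm w)"])
      show "integrable lborel (\<lambda>x. indicator ?C x * (L * norm w))"
        by (rule integrable_indicator_mult_bounded[where K = "L * norm w"]) (auto simp: L)
      show "AE y in lborel. norm ((indicator ?B (y - h n *\<^sub>R v) - indicator ?B y) * dquot F w y (h n))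
          \<le> indicator ?C y * (L * norm w)" for n
      proof (rule AE_I2)
        fix y :: 'a
        have *: "y \<in> ?C" if "y \<in> ?B \<or> y - h n *\<^sub>R v \<in> ?B"
        proof -
          have "norm (h n *\<^sub>R v) \<le> norm v"
            using h1[of n] by (simp add: mult_left_le_one_le)
          moreover have "norm y \<le> norm (y - h n *\<^sub>R v) + norm (h n *\<^sub>R v)"
            using norm_triangle_ineq[of "y - h n *\<^sub>R v" "h n *\<^sub>R v"] by simp
          ultimately show ?thesis
            using that R[of y] R[of "y - h n *\<^sub>R v"] norm_ge_zero[of v]
            by (elim disjE) (simp_all del: norm_ge_zero norm_scaleR)
        qed
        have "\<bar>indicator ?B (y - h n *\<^sub>R v) - indicator ?B y :: real\<bar> \<le> indicator ?C y"
          using * by (auto simp: indicator_def)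
        then show "norm ((indicator ?B (y - h n *\<^sub>R v) - indicator ?B y) * dquot F w y (h n))
          \<le> indicator ?C y * (L * norm w)"
          using abs_dquot_le[OF lip, of w y "h n"] by (auto simp: abs_mult intro!: mult_mono)
      qed
      show "AE y in lborel. (\<lambda>n. (indicator ?B (y - h n *\<^sub>R v) - indicator ?B y) * dquot F w y (h n)) \<longlonglongrightarrow> 0"
        using AE_not_in_frontier_box[of l u]
      proof eventually_elim
        case (elim y)
        have lim: "(\<lambda>n. y - h n *\<^sub>R v) \<longlonglongrightarrow> y"
          using tendsto_diff[OF tendsto_const tendsto_scaleR[OF h(2) tendsto_const], of y v] by simp
        have "\<forall>\<^sub>F n in sequentially. (y - h n *\<^sub>R v \<in> ?B) = (y \<in> ?B)"
        proof (cases "y \<in> ?B")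
          case True
          then show ?thesis using topological_tendstoD[OF lim open_box True] by simp
        next
          case False
          then have "y \<in> - closure ?B"
            using elim interior_subset[of ?B] by (auto simp: frontier_def)
          from topological_tendstoD[OF lim _ this]
          have "\<forall>\<^sub>F n in sequentially. y - h n *\<^sub>R v \<in> - closure ?B" by auto
          then show ?thesis
            by eventually_elim (use False closure_subset in auto)
        qed
        then show ?case
          by (intro tendsto_eventually) (auto elim!: eventually_mono simp: indicator_def)
      qed
    qed auto
    with lim1 show "(\<integral>x. indicator ?B x * \<psi> x \<partial>lborel) = 0"
      by (auto dest: LIMSEQ_unique)
  qed auto
  then show ?thesis by eventually_elim (simp add: \<psi>_def)
qed

lemma tendsto_dquot_scaleR:
  assumes "(dquot F v x \<longlongrightarrow> l) (at 0)"
  shows "(dquot F (c *\<^sub>R v) x \<longlongrightarrow> c * l) (at 0)"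
proof (cases "c = 0")
  case True
  then show ?thesis by (simp add: dquot_zero)
next
  case False
  have "filterlim (\<lambda>h. c * h) (at 0) (at (0::real))"
    using False by (auto simp: filterlim_at eventually_at intro!: tendsto_eq_intros exI[of _ 1])
  then have "((\<lambda>h. c * dquot F v x (c * h)) \<longlongrightarrow> c * l) (at 0)"
    by (intro tendsto_mult tendsto_const filterlim_compose[OF assms])
  moreover have "c * dquot F v x (c * h) = dquot F (c *\<^sub>R v) x h" for h
    using False by (simp add: dquot_def mult.commute)
  ultimately show ?thesis by simp
qed

text \<open>The exceptional null set depends on the direction \<open>v\<close>; the uncountably many directions are dealt with by
density, not here.\<close>

lemma AE_dirderiv_linear:
  fixes F :: "'a::euclidean_space \<Rightarrow> real"
  assumes lip: "L-lipschitz_on UNIV F"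
  shows "AE x in lborel. dirderiv F v x = (\<Sum>b\<in>Basis. (v \<bullet> b) * dirderiv F b x)"
proof -
  have "AE x in lborel. dirderiv F (\<Sum>b\<in>S. (v \<bullet> b) *\<^sub>R b) x = (\<Sum>b\<in>S. (v \<bullet> b) * dirderiv F b x)"
    if "finite S" for S
    using that
  proof (induction S)
    case empty
    have "dirderiv F 0 x = 0" for x
      by (rule dirderiv_eqI) (simp add: dquot_zero)
    then show ?case by simp
  next
    case (insert b S)
    have "AE x in lborel. dirderiv F ((v \<bullet> b) *\<^sub>R b) x = (v \<bullet> b) * dirderiv F b x"
      using AE_dirderiv[OF lip, of b] by eventually_elim (intro dirderiv_eqI tendsto_dquot_scaleR)
    with insert.IH AE_dirderiv_add[OF lip, of "(v \<bullet> b) *\<^sub>R b" "\<Sum>b\<in>S. (v \<bullet> b) *\<^sub>R b"]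
    show ?case
      by eventually_elim (simp add: insert.hyps)
  qed
  from this[OF finite_Basis] show ?thesis by (simp add: euclidean_representation)
qed

section \<open>Rademacher's theorem\<close>

text \<open>A finite subset of the dense set approximates the whole unit sphere, so finitely many directional limits
give one radius that serves all directions; the Lipschitz bound and the boundedness of \<open>A\<close> pay for
replacing a direction by its neighbour.\<close>

lemma has_derivative_if_dense_directional_derivatives:
  fixes F :: "'a::euclidean_space \<Rightarrow> real"
  assumes lip: "L-lipschitz_on UNIV F" and A: "bounded_linear A"
    and dense: "\<And>X. open X \<Longrightarrow> X \<noteq> {} \<Longrightarrow> \<exists>v\<in>V. v \<in> X"
    and dir: "\<And>v. v \<in> V \<Longrightarrow> (dquot F v x \<longlongrightarrow> A v) (at 0)"
  shows "(F has_derivative A) (at x)"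
  unfolding has_derivative_at_alt
proof (intro conjI A allI impI)
  interpret A: bounded_linear A by fact
  fix e :: real assume "0 < e"
  have L: "0 \<le> L" using lip by (rule lipschitz_on_nonneg)
  obtain K where K: "0 < K" "\<And>v. \<bar>A v\<bar> \<le> norm v * K"
    using A.pos_bounded by auto
  \<comment> \<open>The three errors below are \<open>L * \<eta>\<close>, \<open>\<eta>\<close> and \<open>K * \<eta>\<close> per unit length.\<close>
  define \<eta> where "\<eta> = e / (L + K + 1)"
  have \<eta>: "0 < \<eta>" "\<eta> * (L + K + 1) = e" using L K \<open>0 < e\<close> by (auto simp: \<eta>_def)
  have cover: "sphere 0 1 \<subseteq> (\<Union>v\<in>V. ball v \<eta>)"
  proof
    fix u :: 'a
    obtain v where "v \<in> V" "v \<in> ball u \<eta>" using dense[of "ball u \<eta>"] \<eta> by auto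
    then show "u \<in> (\<Union>v\<in>V. ball v \<eta>)" by (auto simp: dist_commute)
  qed
  obtain V0 where V0: "V0 \<subseteq> V" "finite V0" "sphere 0 1 \<subseteq> (\<Union>v\<in>V0. ball v \<eta>)"
    using compactE_image[OF compact_sphere _ cover] by blast
  have "\<forall>\<^sub>F h in at 0. \<forall>v\<in>V0. dist (dquot F v x h) (A v) < \<eta>"
    using V0 \<eta> by (intro eventually_ball_finite ballI tendstoD dir) auto
  then obtain d where d: "0 < d"
      "\<And>h v. h \<noteq> 0 \<Longrightarrow> \<bar>h\<bar> < d \<Longrightarrow> v \<in> V0 \<Longrightarrow> \<bar>dquot F v x h - A v\<bar> < \<eta>"
    by (auto simp: eventually_at dist_real_def)
  show "\<exists>d>0. \<forall>y. norm (y - x) < d \<longrightarrow> norm (F y - F x - A (y - x)) \<le> e * norm (y - x)"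
  proof (intro exI[of _ d] conjI allI impI)
    fix y assume y: "norm (y - x) < d"
    show "norm (F y - F x - A (y - x)) \<le> e * norm (y - x)"
    proof (cases "y = x")
      case False
      define t where "t = norm (y - x)"
      define u where "u = (y - x) /\<^sub>R t"
      have t: "0 < t" "t < d" using False y by (auto simp: t_def)
      have y_eq: "y = x + t *\<^sub>R u" using t by (simp add: u_def)
      have "norm u = 1" using t by (simp add: u_def flip: t_def)
      then obtain v where v: "v \<in> V0" "norm (u - v) < \<eta>"
        using V0(3) by (force simp: dist_norm norm_minus_commute)
      have "\<bar>F (x + t *\<^sub>R u) - F (x + t *\<^sub>R v)\<bar> \<le> L * norm (t *\<^sub>R (u - v))"
        using lipschitz_onD[OF lip, of "x + t *\<^sub>R u" "x + t *\<^sub>R v"]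
        by (simp add: dist_norm scaleR_diff_right)
      also have "\<dots> \<le> t * (L * \<eta>)"
        using v L t by (simp add: mult_left_mono mult.left_commute)
      finally have 1: "\<bar>F (x + t *\<^sub>R u) - F (x + t *\<^sub>R v)\<bar> \<le> t * (L * \<eta>)" .
      have "\<bar>t * (dquot F v x t - A v)\<bar> \<le> t * \<eta>"
        using d(2)[of t v] t v by (simp add: abs_mult)
      then have 2: "\<bar>F (x + t *\<^sub>R v) - F x - t * A v\<bar> \<le> t * \<eta>"
        using t by (simp add: dquot_def right_diff_distrib diff_divide_distrib)
      have "\<bar>A (u - v)\<bar> \<le> \<eta> * K"
        using K(2)[of "u - v"] v K(1) by (smt (verit) mult_right_mono)
      then have "\<bar>t * A (u - v)\<bar> \<le> t * (\<eta> * K)"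
        using t by (simp add: abs_mult)
      then have 3: "\<bar>t * A v - t * A u\<bar> \<le> t * (\<eta> * K)"
        by (simp add: A.diff right_diff_distrib abs_minus_commute)
      have "\<bar>F y - F x - A (y - x)\<bar> \<le> t * (L * \<eta>) + t * \<eta> + t * (\<eta> * K)"
        using 1 2 3 by (simp add: y_eq A.scaleR)
      also have "\<dots> = (\<eta> * (L + K + 1)) * t" by (simp add: algebra_simps)
      finally show ?thesis using \<eta>(2) by (simp add: t_def)
    qed simp
  qed fact
qed

text \<open>Componentwise, the derivatives along a countable dense set of directions exist and depend linearly on the
direction outside a single null set.\<close>

theorem rademacher:
  fixes f :: "'a::euclidean_space \<Rightarrow> 'b::euclidean_space"
  assumes lip: "L-lipschitz_on UNIV f"
  shows "AE x in lborel. f differentiable (at x)"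
proof -
  obtain V :: "'a set" where V: "countable V" "\<And>X. open X \<Longrightarrow> X \<noteq> {} \<Longrightarrow> \<exists>v\<in>V. v \<in> X"
    using countable_dense_exists by blast
  have "AE x in lborel. (\<lambda>x. f x \<bullet> i) differentiable (at x)" if i: "i \<in> Basis" for i
  proof -
    let ?F = "\<lambda>x. f x \<bullet> i"
    have lipF: "L-lipschitz_on UNIV ?F"
    proof (rule lipschitz_onI)
      fix x y
      have "dist (?F x) (?F y) \<le> dist (f x) (f y)"
        using Basis_le_norm[OF i, of "f x - f y"] by (simp add: dist_norm inner_diff_left)
      also have "\<dots> \<le> L * dist x y" using lip by (rule lipschitz_onD) auto
      finally show "dist (?F x) (?F y) \<le> L * dist x y" .
    qed (rule lipschitz_on_nonneg[OF lip])
    have "AE x in lborel. \<forall>v\<in>V. (dquot ?F v x \<longlongrightarrow> (\<Sum>b\<in>Basis. (v \<bullet> b) * dirderiv ?F b x)) (at 0)"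
      unfolding AE_ball_countable[OF V(1)]
    proof
      fix v
      show "AE x in lborel. (dquot ?F v x \<longlongrightarrow> (\<Sum>b\<in>Basis. (v \<bullet> b) * dirderiv ?F b x)) (at 0)"
        using AE_dirderiv[OF lipF, of v] AE_dirderiv_linear[OF lipF, of v]
        by eventually_elim simp
    qed
    then show ?thesis
    proof eventually_elim
      case (elim x)
      have "bounded_linear (\<lambda>v. \<Sum>b\<in>Basis. (v \<bullet> b) * dirderiv ?F b x)"
        by (intro bounded_linear_sum bounded_linear_mult_const bounded_linear_inner_left)
      from has_derivative_if_dense_directional_derivatives[OF lipF this V(2)] elim
      show ?case by (auto simp: differentiable_def)
    qed
  qed
  then have "AE x in lborel. \<forall>i\<in>Basis. (\<lambda>x. f x \<bullet> i) differentiable (at x)"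
    by (intro AE_finite_allI) auto
  then show ?thesis
    by eventually_elim (simp add: differentiable_componentwise_within[of f])
qed

section \<open>Mean value inequalities\<close>

lemma AE_lborel_shift:
  fixes c :: "'a::euclidean_space"
  assumes "AE x in lborel. P x"
  shows "AE x in lborel. P (x + c)"
proof -
  have "AE x in distr lborel borel ((+) c). P x"
    using assms by (subst lborel_distr_plus)
  then have "AE x in lborel. P (c + x)"
    by (rule AE_distrD[rotated]) simp
  then show ?thesis by (simp add: add.commute)
qed

lemma has_derivative_dquot:
  assumes "(F has_derivative D) (at x)"
  shows "(dquot F v x \<longlongrightarrow> D v) (at 0)"
proof -
  interpret D: bounded_linear D using assms by (rule has_derivative_bounded_linear)
  have "((\<lambda>h. F (x + h *\<^sub>R v)) has_derivative (\<lambda>h. D (h *\<^sub>R v))) (at 0)"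
    using assms by (auto intro!: derivative_eq_intros has_derivative_compose[of "\<lambda>h. x + h *\<^sub>R v" _ 0 UNIV F D])
  then have "((\<lambda>h. F (x + h *\<^sub>R v)) has_field_derivative D v) (at 0)"
    by (simp add: has_field_derivative_def D.scaleR mult_commute_abs)
  then show ?thesis
    by (simp add: DERIV_def dquot_def[abs_def])
qed

text \<open>The segment from \<open>x\<close> to \<open>y\<close> is itself a null set and may miss every point of differentiability. Averaging
\<open>F\<close> over a small ball that is moved along the segment repairs this: by dominated convergence the average
is differentiable at every position, with derivative the average of the directional derivative, to which the
almost everywhere bound applies. The ordinary mean value theorem bounds the increment of the average, and
the Lipschitz bound compares it with the increment of \<open>F\<close> as the ball shrinks.\<close>

lemma lipschitz_increment_le_AE:
  fixes F :: "'a::euclidean_space \<Rightarrow> real"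
  assumes lip: "L-lipschitz_on UNIV F"
    and S: "open S" "convex S" "x \<in> S" "y \<in> S"
    and bound: "AE z in lborel. \<forall>D. z \<in> S \<and> (F has_derivative D) (at z) \<longrightarrow> D (y - x) \<le> c"
  shows "F y - F x \<le> c"
proof -
  define v where "v = y - x"
  have cont: "continuous_on UNIV F" using lip by (rule lipschitz_on_continuous_on)
  have [measurable]: "F \<in> borel_measurable borel"
    using cont by (rule borel_measurable_continuous_onI)
  have [measurable]: "(\<lambda>z. dirderiv F v (z + s *\<^sub>R v)) \<in> borel_measurable borel"
    "(\<lambda>z. dquot F v (z + s *\<^sub>R v) h) \<in> borel_measurable borel" for s h
    by (auto intro!: measurable_compose[OF _ dirderiv_measurable[OF cont]]
          measurable_compose[OF _ dquot_measurable[OF cont]])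
  obtain e1 e2 where e12: "0 < e1" "ball x e1 \<subseteq> S" "0 < e2" "ball y e2 \<subseteq> S"
    using S by (meson openE)
  have le: "F y - F x \<le> c + 2 * L * e" if e: "0 < e" "e < min e1 e2" for e
  proof -
    let ?B = "ball x e"
    have [measurable]: "?B \<in> sets borel" by simp
    define \<phi> where "\<phi> s = (\<integral>z. indicator ?B z * F (z + s *\<^sub>R v) \<partial>lborel)" for s
    define \<phi>' where "\<phi>' s = (\<integral>z. indicator ?B z * dirderiv F v (z + s *\<^sub>R v) \<partial>lborel)" for s
    have int: "integrable lborel (\<lambda>z. indicator ?B z * F (z + s *\<^sub>R v))" for s
    proof (rule integrable_indicator_mult_bounded[where K = "\<bar>F x\<bar> + L * (e + norm (s *\<^sub>R v))"])
      show "AE z in lborel. z \<in> ?B \<longrightarrow> \<bar>F (z + s *\<^sub>R v)\<bar> \<le> \<bar>F x\<bar> + L * (e + norm (s *\<^sub>R v))"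
      proof (intro AE_I2 impI)
        fix z assume "z \<in> ?B"
        then have "norm (z + s *\<^sub>R v - x) \<le> e + norm (s *\<^sub>R v)"
          using norm_triangle_ineq[of "z - x" "s *\<^sub>R v"] by (simp add: dist_norm norm_minus_commute algebra_simps)
        then have "L * norm (z + s *\<^sub>R v - x) \<le> L * (e + norm (s *\<^sub>R v))"
          using lipschitz_on_nonneg[OF lip] by (rule mult_left_mono)
        then show "\<bar>F (z + s *\<^sub>R v)\<bar> \<le> \<bar>F x\<bar> + L * (e + norm (s *\<^sub>R v))"
          using lipschitz_onD[OF lip, of "z + s *\<^sub>R v" x] by (simp add: dist_norm)
      qed
    qed auto
    have int': "integrable lborel (\<lambda>z. indicator ?B z * C)" for C :: real
      by (rule integrable_indicator_mult_bounded[where K = "\<bar>C\<bar>"]) auto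
    have deriv: "(\<phi> has_real_derivative \<phi>' s) (at s)" for s
      unfolding DERIV_def tendsto_at_iff_sequentially comp_def
    proof (intro allI impI)
      fix h :: "nat \<Rightarrow> real" assume "\<forall>n. h n \<in> UNIV - {0}" "h \<longlonglongrightarrow> 0"
      then have h: "h n \<noteq> 0" "filterlim h (at 0) sequentially" for n
        by (auto simp: filterlim_at)
      have quot: "(\<phi> (s + h n) - \<phi> s) / h n
          = (\<integral>z. indicator ?B z * dquot F v (z + s *\<^sub>R v) (h n) \<partial>lborel)" for n
      proof -
        have "indicator ?B z * dquot F v (z + s *\<^sub>R v) (h n)
          = (indicator ?B z * F (z + (s + h n) *\<^sub>R v) - indicator ?B z * F (z + s *\<^sub>R v)) / h n" for z
          by (simp add: dquot_def scaleR_add_left add.assoc flip: right_diff_distrib)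
        then show ?thesis using int by (simp add: \<phi>_def)
      qed
      show "(\<lambda>n. (\<phi> (s + h n) - \<phi> s) / h n) \<longlonglongrightarrow> \<phi>' s"
        unfolding quot \<phi>'_def
      proof (rule integral_dominated_convergence[where w = "\<lambda>z. indicator ?B z * (L * norm v)"])
        show "integrable lborel (\<lambda>z. indicator ?B z * (L * norm v))" by (rule int')
        show "AE z in lborel. (\<lambda>n. indicator ?B z * dquot F v (z + s *\<^sub>R v) (h n))
            \<longlonglongrightarrow> indicator ?B z * dirderiv F v (z + s *\<^sub>R v)"
          using AE_lborel_shift[OF AE_dirderiv[OF lip, of v], of "s *\<^sub>R v"]
          by eventually_elim (intro tendsto_mult tendsto_const filterlim_compose[OF _ h(2)])
        show "AE z in lborel. norm (indicator ?B z * dquot F v (z + s *\<^sub>R v) (h n))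
            \<le> indicator ?B z * (L * norm v)" for n
          by (auto simp: abs_mult abs_dquot_le[OF lip] split: split_indicator)
      qed auto
    qed
    have deriv_le: "\<phi>' s \<le> c * measure lborel ?B" if s: "0 \<le> s" "s \<le> 1" for s
    proof -
      have in_S: "z + s *\<^sub>R v \<in> S" if "z \<in> ?B" for z
      proof -
        have "z \<in> S" using that e e12 by auto
        moreover have "z + v \<in> S"
          using that e e12 by (auto simp: v_def dist_norm subset_eq algebra_simps)
        moreover have "z + s *\<^sub>R v = (1 - s) *\<^sub>R z + s *\<^sub>R (z + v)" by (simp add: algebra_simps)
        ultimately show ?thesis using S(2) s by (simp add: convex_alt)
      qed
      have "\<phi>' s \<le> (\<integral>z. indicator ?B z * c \<partial>lborel)"
        unfolding \<phi>'_def
      proof (rule integral_mono_AE)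
        show "integrable lborel (\<lambda>z. indicator ?B z * dirderiv F v (z + s *\<^sub>R v))"
        proof (rule integrable_indicator_mult_bounded[where K = "L * norm v"])
          show "AE z in lborel. z \<in> ?B \<longrightarrow> \<bar>dirderiv F v (z + s *\<^sub>R v)\<bar> \<le> L * norm v"
            using AE_lborel_shift[OF AE_dirderiv[OF lip, of v], of "s *\<^sub>R v"]
            by eventually_elim (auto intro: abs_dirderiv_le[OF lip])
        qed auto
        show "AE z in lborel. indicator ?B z * dirderiv F v (z + s *\<^sub>R v) \<le> indicator ?B z * c"
          using AE_lborel_shift[OF rademacher[OF lip], of "s *\<^sub>R v"] AE_lborel_shift[OF bound, of "s *\<^sub>R v"]
        proof eventually_elim
          case (elim z)
          obtain D where D: "(F has_derivative D) (at (z + s *\<^sub>R v))"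
            using elim(1) by (auto simp: differentiable_def)
          have "dirderiv F v (z + s *\<^sub>R v) = D v"
            using D by (intro dirderiv_eqI has_derivative_dquot)
          then show ?case
            using elim(2) D in_S[of z] by (auto simp: v_def split: split_indicator)
        qed
      qed (rule int')
      then show ?thesis by (simp add: mult.commute)
    qed
    obtain s where s: "0 < s" "s < 1" "\<phi> 1 - \<phi> 0 = (1 - 0) * \<phi>' s"
      using MVT2[of 0 1 \<phi> \<phi>'] deriv by auto
    have "(F y - F x - 2 * L * e) * measure lborel ?B = (\<integral>z. indicator ?B z * (F y - F x - 2 * L * e) \<partial>lborel)"
      by (simp add: mult.commute)
    also have "\<dots> \<le> (\<integral>z. indicator ?B z * F (z + 1 *\<^sub>R v) - indicator ?B z * F (z + 0 *\<^sub>R v) \<partial>lborel)"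
    proof (rule integral_mono)
      fix z :: 'a
      have "F y - F x - 2 * L * e \<le> F (z + v) - F z" if "z \<in> ?B"
      proof -
        have "L * dist x z \<le> L * e"
          using that lipschitz_on_nonneg[OF lip] by (intro mult_left_mono) auto
        moreover have "\<bar>F y - F (z + v)\<bar> \<le> L * dist x z"
          using lipschitz_onD[OF lip, of y "z + v"] by (simp add: v_def dist_norm algebra_simps)
        moreover have "\<bar>F x - F z\<bar> \<le> L * dist x z"
          using lipschitz_onD[OF lip, of x z] by (simp add: dist_real_def)
        ultimately show ?thesis by linarith
      qed
      then show "indicator ?B z * (F y - F x - 2 * L * e)
          \<le> indicator ?B z * F (z + 1 *\<^sub>R v) - indicator ?B z * F (z + 0 *\<^sub>R v)"
        by (auto split: split_indicator)
    qed (intro int' Bochner_Integration.integrable_diff int)+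
    also have "\<dots> = \<phi> 1 - \<phi> 0"
      unfolding \<phi>_def by (intro Bochner_Integration.integral_diff int)
    also have "\<dots> \<le> c * measure lborel ?B"
      using s deriv_le[of s] by simp
    finally have "F y - F x - 2 * L * e \<le> c"
      using content_ball_pos[OF e(1), of x] by simp
    then show ?thesis by simp
  qed
  have "((\<lambda>e. c + 2 * L * e) \<longlongrightarrow> c + 2 * L * 0) (at_right 0)"
    by (intro tendsto_intros)
  moreover have "\<forall>\<^sub>F e in at_right 0. F y - F x \<le> c + 2 * L * e"
    using e12 le by (intro eventually_at_rightI[of 0 "min e1 e2"]) auto
  ultimately show ?thesis
    using tendsto_lowerbound[of "\<lambda>e. c + 2 * L * e" c "at_right 0" "F y - F x"] by simp
qed

text \<open>The norm of the increment is its component in its own direction \<open>u\<close>. Differentiability of \<open>u \<bullet> f\<close> alone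
does not provide a derivative of \<open>f\<close> to bound, so Rademacher's theorem is applied to the vector-valued \<open>f\<close>.\<close>

lemma lipschitz_mean_value_inequality:
  fixes f :: "'a::euclidean_space \<Rightarrow> 'b::euclidean_space"
  assumes lip: "L-lipschitz_on UNIV f"
    and S: "open S" "convex S" "x \<in> S" "y \<in> S"
    and bound: "\<And>z D. z \<in> S \<Longrightarrow> (f has_derivative D) (at z) \<Longrightarrow> norm (D (y - x)) \<le> c"
  shows "norm (f y - f x) \<le> c"
proof -
  define u where "u = sgn (f y - f x)"
  have u: "norm u \<le> 1" by (simp add: u_def norm_sgn)
  have inner_le: "u \<bullet> w \<le> norm w" for w
    using norm_cauchy_schwarz[of u w] u mult_left_le_one_le[of "norm w" "norm u"] by simp
  have "u \<bullet> f y - u \<bullet> f x \<le> c"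
  proof (rule lipschitz_increment_le_AE[OF _ S])
    show "L-lipschitz_on UNIV (\<lambda>z. u \<bullet> f z)"
    proof (rule lipschitz_onI)
      fix a b
      have "dist (u \<bullet> f a) (u \<bullet> f b) \<le> dist (f a) (f b)"
        using inner_le[of "f a - f b"] inner_le[of "f b - f a"]
        by (simp add: dist_norm inner_diff_right abs_le_iff norm_minus_commute)
      also have "\<dots> \<le> L * dist a b" using lip by (rule lipschitz_onD) auto
      finally show "dist (u \<bullet> f a) (u \<bullet> f b) \<le> L * dist a b" .
    qed (rule lipschitz_on_nonneg[OF lip])
    show "AE z in lborel. \<forall>D. z \<in> S \<and> ((\<lambda>z. u \<bullet> f z) has_derivative D) (at z) \<longrightarrow> D (y - x) \<le> c"
      using rademacher[OF lip]
    proof eventually_elim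
      case (elim z)
      obtain D where D: "(f has_derivative D) (at z)"
        using elim by (auto simp: differentiable_def)
      have "((\<lambda>z. u \<bullet> f z) has_derivative (\<lambda>w. u \<bullet> D w)) (at z)"
        using D by (rule has_derivative_inner_right)
      then have "D' = (\<lambda>w. u \<bullet> D w)" if "((\<lambda>z. u \<bullet> f z) has_derivative D') (at z)" for D'
        using that has_derivative_unique by blast
      then show ?case
        using bound[OF _ D] inner_le[of "D (y - x)"] by fastforce
    qed
  qed
  moreover have "u \<bullet> (f y - f x) = norm (f y - f x)"
    by (cases "f y = f x") (simp_all add: u_def sgn_div_norm power2_norm_eq_inner[symmetric] power2_eq_square)
  ultimately show ?thesis by (simp add: inner_diff_right)
qed

lemma locally_lipschitz_imp_lipschitz_on_compact:
  assumes "locally_lipschitz f" "compact S"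
  obtains L where "L-lipschitz_on S f"
proof -
  have "local_lipschitz {0::real} S (\<lambda>_. f)"
  proof (rule local_lipschitzI)
    fix t :: real and x assume "x \<in> S"
    obtain u L where uL: "0 < u" "L-lipschitz_on (ball x u) f"
      using assms(1) unfolding locally_lipschitz_def by blast
    have "cball x (u/2) \<inter> S \<subseteq> ball x u" using uL(1) by auto
    then show "\<exists>u>0. \<exists>L. \<forall>t\<in>cball t u \<inter> {0}. L-lipschitz_on (cball x u \<inter> S) f"
      using uL lipschitz_on_subset[OF uL(2)] by (intro exI[of _ "u/2"]) auto
  qed
  from local_lipschitz_compact_implies_lipschitz[OF this \<open>compact S\<close> compact_sing] that
  show ?thesis by auto
qed

text \<open>Composing \<open>f\<close> with the nearest-point projection onto the compact convex closure of \<open>S\<close> gives a globally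
Lipschitz function that has the same values and derivatives on \<open>S\<close>.\<close>

lemma locally_lipschitz_mean_value_inequality:
  fixes f :: "'a::euclidean_space \<Rightarrow> 'b::euclidean_space"
  assumes lip: "locally_lipschitz f"
    and S: "open S" "convex S" "bounded S" "x \<in> S" "y \<in> S"
    and bound: "\<And>z D. z \<in> S \<Longrightarrow> (f has_derivative D) (at z) \<Longrightarrow> norm (D (y - x)) \<le> c"
  shows "norm (f y - f x) \<le> c"
proof -
  let ?C = "closure S"
  define g where "g z = f (closest_point ?C z)" for z
  have C: "closed ?C" "convex ?C" "?C \<noteq> {}" "compact ?C"
    using S closure_subset[of S] by (auto simp: compact_closure convex_closure)
  obtain L where L: "L-lipschitz_on ?C f"
    using locally_lipschitz_imp_lipschitz_on_compact[OF lip C(4)] by blast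
  have g_lip: "L-lipschitz_on UNIV g"
  proof (rule lipschitz_onI)
    fix a b
    have "dist (g a) (g b) \<le> L * dist (closest_point ?C a) (closest_point ?C b)"
      unfolding g_def using C by (intro lipschitz_onD[OF L] closest_point_in_set)
    also have "\<dots> \<le> L * dist a b"
      using C lipschitz_on_nonneg[OF L] by (intro mult_left_mono closest_point_lipschitz)
    finally show "dist (g a) (g b) \<le> L * dist a b" .
  qed (rule lipschitz_on_nonneg[OF L])
  have eq: "g z = f z" if "z \<in> S" for z
    using that closure_subset[of S] by (auto simp: g_def closest_point_self)
  have "norm (g y - g x) \<le> c"
  proof (rule lipschitz_mean_value_inequality[OF g_lip S(1,2,4,5)])
    fix z D assume z: "z \<in> S" and D: "(g has_derivative D) (at z)"
    from D have "(f has_derivative D) (at z)"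
      by (rule has_derivative_transform_within_open[OF _ S(1) z]) (simp add: eq)
    then show "norm (D (y - x)) \<le> c" by (rule bound[OF z])
  qed
  then show ?thesis by (simp add: eq S)
qed

section \<open>The growth condition\<close>

text \<open>The constant sequence is one of the sequences in the definition, so the growth condition bounds the
derivative wherever it exists.\<close>

lemma jacobian_in_clarke_subdifferential:
  assumes "f differentiable (at z)"
  shows "jacobian f (at z) \<in> clarke_subdifferential f z"
  unfolding clarke_subdifferential_def
  using assms by (intro hull_inc CollectI exI[of _ "\<lambda>_. z"]) auto

theorem lemma1:
  fixes f :: "real^'d \<Rightarrow> real^'m"
    and \<alpha> :: "real^'d \<Rightarrow> real"
    and \<beta> :: "real^'d \<Rightarrow> real \<Rightarrow> real"
  assumes "\<And>x. 0 \<le> \<alpha> x"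
    and "continuous_on UNIV \<alpha>"
    and "\<And>x r. 0 \<le> r \<Longrightarrow> 0 \<le> \<beta> x r"
    and "continuous_on (UNIV \<times> {0..}) (\<lambda>(x, r). \<beta> x r)"
    and "\<And>x. mono_on {0..} (\<beta> x)"
    and "locally_lipschitz f"
    and "subgradient_growth f \<alpha> \<beta>"
  shows "\<forall>x y. norm (f x - f y) \<le> (\<alpha> x + \<beta> x (norm (y - x))) * norm (x - y)"
proof (intro allI)
  fix x y :: "real^'d"
  define r where "r = norm (y - x)"
  have r: "0 \<le> r" by (simp add: r_def)
  have deriv_le: "norm (D w) \<le> \<alpha> z * norm w" if D: "(f has_derivative D) (at z)" for z D w
  proof -
    let ?J = "jacobian f (at z)"
    have diff: "f differentiable (at z)" using D by (auto simp: differentiable_def)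
    then have D_eq: "D = (\<lambda>w. ?J *v w)"
      using D jacobian_works has_derivative_unique by blast
    have "ereal (onorm (\<lambda>w. ?J *v w)) \<le> (SUP \<zeta>\<in>clarke_subdifferential f z. ereal (onorm (\<lambda>w. \<zeta> *v w)))"
      using jacobian_in_clarke_subdifferential[OF diff] by (rule SUP_upper)
    also have "\<dots> \<le> ereal (\<alpha> z)"
      using assms(7) by (simp add: subgradient_growth_def)
    finally have "onorm D \<le> \<alpha> z" by (simp add: D_eq)
    then have "onorm D * norm w \<le> \<alpha> z * norm w" by (rule mult_right_mono) simp
    with onorm[OF has_derivative_bounded_linear[OF D], of w] show ?thesis by linarith
  qed
  \<comment> \<open>An open ball around \<open>x\<close> that contains \<open>y\<close> has radius larger than \<open>r\<close>; hence the slack \<open>e\<close>.\<close>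
  have le: "norm (f y - f x) \<le> (\<alpha> x + \<beta> x (r + e)) * r" if "0 < e" for e
  proof (rule locally_lipschitz_mean_value_inequality[OF assms(6), where S = "ball x (r + e)"])
    fix z D assume z: "z \<in> ball x (r + e)" and D: "(f has_derivative D) (at z)"
    have "\<alpha> z \<le> \<alpha> x + \<beta> x (norm (z - x))"
      using assms(7) by (simp add: subgradient_growth_def) (smt (verit))
    also have "\<beta> x (norm (z - x)) \<le> \<beta> x (r + e)"
      using z r \<open>0 < e\<close> by (intro mono_onD[OF assms(5)]) (auto simp: dist_norm norm_minus_commute)
    finally have "\<alpha> z * r \<le> (\<alpha> x + \<beta> x (r + e)) * r" using r by (simp add: mult_right_mono)
    with deriv_le[OF D, of "y - x"] show "norm (D (y - x)) \<le> (\<alpha> x + \<beta> x (r + e)) * r"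
      by (simp add: r_def)
  qed (use \<open>0 < e\<close> r in \<open>auto simp: r_def dist_norm norm_minus_commute add_nonneg_pos\<close>)
  have "((\<lambda>e. (\<lambda>(x, r). \<beta> x r) (x, r + e)) \<longlongrightarrow> (\<lambda>(x, r). \<beta> x r) (x, r)) (at_right 0)"
  proof (rule continuous_on_tendsto_compose[OF assms(4)])
    show "((\<lambda>e. (x, r + e)) \<longlongrightarrow> (x, r)) (at_right 0)"
      by (auto intro!: tendsto_eq_intros)
    show "\<forall>\<^sub>F e in at_right 0. (x, r + e) \<in> UNIV \<times> {0..}"
      using r by (intro eventually_at_rightI[of 0 1]) auto
  qed (use r in auto)
  then have "((\<lambda>e. (\<alpha> x + \<beta> x (r + e)) * r) \<longlongrightarrow> (\<alpha> x + \<beta> x r) * r) (at_right 0)"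
    by (intro tendsto_intros) simp
  moreover have "\<forall>\<^sub>F e in at_right 0. norm (f y - f x) \<le> (\<alpha> x + \<beta> x (r + e)) * r"
    using le by (intro eventually_at_rightI[of 0 1]) auto
  ultimately have "norm (f y - f x) \<le> (\<alpha> x + \<beta> x r) * r"
    by (rule tendsto_lowerbound) simp
  then show "norm (f x - f y) \<le> (\<alpha> x + \<beta> x (norm (y - x))) * norm (x - y)"
    by (simp add: r_def norm_minus_commute)
qed

end
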